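(* Let $\{(\boldsymbol X(t),V(t)),t\ge 0\}$ be the cyclic random motion in $\mathbb R^3$ with the regular-tetrahedron directions described in the context, speed $c>0$, started from the origin with initial direction $\vec v_1$, with intertimes along $\vec v_j$ given by independent geometric counting processes with intensities $\lambda_j>0$, $1\le j\le4$, and let $p_1(\boldsymbol x,t)$, for $t>0$ and $\boldsymbol x\in\mathrm{Int}(\mathcal T(t))$, be the density of $\boldsymbol X(t)$ on $\mathrm{Int}(\mathcal T(t))$. Then, for every fixed $\boldsymbol x\in\mathbb R^3$ (which belongs to $\mathrm{Int}(\mathcal T(t))$ for all sufficiently large $t$), $$\lim_{t\to+\infty}p_1(\boldsymbol x,t)=0.$$
   Context: Directions: $\vec v_1=(1,0,0)$, $\vec v_2=(-\tfrac13,\tfrac{2\sqrt2}3,0)$, $\vec v_3=(-\tfrac13,-\tfrac{\sqrt2}3,\sqrt{\tfrac23})$, $\vec v_4=(-\tfrac13,-\tfrac{\sqrt2}3,-\sqrt{\tfrac23})$. $\mathcal T(t)$ is the regular tetrahedron with vertices $ct\,\vec v_j$, $1\le j\le4$. Durations. For each $j\in\{1,2,3,4\}$, $(D_{j,k})_{k\ge1}$ is the sequence of interarrival times of a geometric counting process (GCP) with intensity $\lambda_j>0$: a mixed Poisson process whose random intensity $\alpha_j$ is exponentially distributed with mean $\lambda_j$ (given $\alpha_j$, the $D_{j,k}$, $k\ge 1$, are i.i.d. exponential with rate $\alpha_j$). The four sequences are mutually independent. Put $D_j^{(0)}=0$, $D_j^{(k)}=\sum_{i=1}^kD_{j,i}$.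 Motion. The particle starts at the origin at time $0$ with direction $\vec v_1$ and takes directions cyclically $\vec v_1\to\vec v_2\to\vec v_3\to\vec v_4\to\vec v_1\to\cdots$; during the $k$-th cycle it moves along $\vec v_j$ for a time $D_{j,k}$. Thus the switching times are $T_0=0$ and $T_{4n+j}=\sum_{r=1}^{j}D_r^{(n+1)}+\sum_{r=j+1}^{4}D_r^{(n)}$ for $n\ge0$, $1\le j\le4$; $V(t)=\vec v_j$ for $T_{4n+j-1}\le t<T_{4n+j}$; and $\boldsymbol X(t)=c\int_0^tV(s)\,ds$. $\mathbb P_1$ denotes probability conditional on $\{\boldsymbol X(0)=\boldsymbol 0, V(0)=\vec v_1\}$. Density: $p_1(\boldsymbol x,t)=\sum_{j=1}^4p_{1j}(\boldsymbol x,t)$, where $p_{1j}(\cdot,t)$ is the continuous function on $\mathrm{Int}(\mathcal T(t))$ with $\mathbb P_1\{\boldsymbol X(t)\in B,V(t)=\vec v_j\}=\int_Bp_{1j}(\boldsymbol x,t)\,d\boldsymbol x$ for Borel $B\subseteq\mathrm{Int}(\mathcal T(t))$ (the continuous version of the absolutely continuous component of the law). *)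

theory Defs
  imports "HOL-Probability.Probability"
begin

section \<open>Geometry\<close>

text \<open>The directions are indexed by 1, 2, 3, 4; other indices are irrelevant.\<close>

definition tetra_dir :: "nat \<Rightarrow> real^3" where
  "tetra_dir j =
    (if j = 1 then vector [1, 0, 0]
     else if j = 2 then vector [- 1/3, 2 * sqrt 2 / 3, 0]
     else if j = 3 then vector [- 1/3, - sqrt 2 / 3, sqrt (2/3)]
     else vector [- 1/3, - sqrt 2 / 3, - sqrt (2/3)])"

definition tetrahedron :: "real \<Rightarrow> real \<Rightarrow> (real^3) set" where
  "tetrahedron c t = convex hull ((\<lambda>j. (c * t) *\<^sub>R tetra_dir j) ` {1..4})"


section \<open>Geometric counting processes\<close>

text \<open>
  Conditionally on the random intensity \<open>\<alpha>\<close>, the times \<open>D k\<close>, \<open>k \<ge> 1\<close>, are i.i.d. exponential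
  with rate \<open>\<alpha>\<close>: the conditional probability, given the sigma-algebra generated by \<open>\<alpha>\<close>, of
  finitely many events \<open>D k \<in> B k\<close> is the product of the corresponding exponential probabilities.
\<close>

definition mixed_poisson_interarrivals ::
    "'a measure \<Rightarrow> ('a \<Rightarrow> real) \<Rightarrow> (nat \<Rightarrow> 'a \<Rightarrow> real) \<Rightarrow> bool" where
  "mixed_poisson_interarrivals M \<alpha> D \<longleftrightarrow>
     \<alpha> \<in> borel_measurable M \<and> (\<forall>k\<ge>1. D k \<in> borel_measurable M) \<and>
     (\<forall>K B. finite K \<and> K \<subseteq> {1..} \<and> (\<forall>k\<in>K. B k \<in> sets borel) \<longrightarrow>
        (AE \<omega> in M.
           real_cond_exp M (vimage_algebra (space M) \<alpha> borel)
             (indicator {\<omega> \<in> space M. \<forall>k\<in>K. D k \<omega> \<in> B k}) \<omega> =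
           (\<Prod>k\<in>K. measure (density lborel (exponential_density (\<alpha> \<omega>))) (B k))))"

text \<open>The library's \<open>exponential_density\<close> is parametrised by the rate, so mean \<open>l\<close> is rate \<open>1 / l\<close>.\<close>

definition gcp_interarrivals :: "'a measure \<Rightarrow> real \<Rightarrow> (nat \<Rightarrow> 'a \<Rightarrow> real) \<Rightarrow> bool" where
  "gcp_interarrivals M l D \<longleftrightarrow>
     (\<exists>\<alpha>. distributed M lborel \<alpha> (exponential_density (1 / l)) \<and>
          mixed_poisson_interarrivals M \<alpha> D)"


section \<open>The cyclic motion\<close>

text \<open>
  Here \<open>d j k\<close> is the realised duration of the \<open>k\<close>-th displacement along direction \<open>j\<close>
  (\<open>1 \<le> j \<le> 4\<close>, \<open>k \<ge> 1\<close>).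
\<close>

definition total_duration :: "(nat \<Rightarrow> nat \<Rightarrow> real) \<Rightarrow> nat \<Rightarrow> nat \<Rightarrow> real" where
  "total_duration d j k = (\<Sum>i=1..k. d j i)"

text \<open>
  The index \<open>m\<close> is written as \<open>4 n + j\<close> with \<open>0 \<le> j \<le> 3\<close>; the case \<open>j = 0\<close> gives both
  \<open>T\<^sub>0 = 0\<close> and, with \<open>n\<close> replaced by \<open>n + 1\<close>, the last switching time of a cycle.
\<close>

definition switching_time :: "(nat \<Rightarrow> nat \<Rightarrow> real) \<Rightarrow> nat \<Rightarrow> real" where
  "switching_time d m =
     (\<Sum>r=1..m mod 4. total_duration d r (m div 4 + 1)) +
     (\<Sum>r=m mod 4 + 1..4. total_duration d r (m div 4))"

lemma switching_time_0: "switching_time d 0 = 0"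
  by (simp add: switching_time_def total_duration_def)

lemma switching_time_cycle:
  assumes "1 \<le> j" "j \<le> 4"
  shows "switching_time d (4 * n + j) =
     (\<Sum>r=1..j. total_duration d r (n + 1)) + (\<Sum>r=j + 1..4. total_duration d r n)"
proof (cases "j = 4")
  case True
  then have "(4 * n + j) mod 4 = 0" "(4 * n + j) div 4 = n + 1" by simp_all
  with True show ?thesis by (simp add: switching_time_def)
next
  case False
  with assms have "(4 * n + j) mod 4 = j" "(4 * n + j) div 4 = n" by simp_all
  then show ?thesis by (simp add: switching_time_def)
qed

text \<open>
  For positive durations the index \<open>m = 4 n + j - 1\<close> below is unique; taking the least one only
  makes the definition total on a null set of paths (see \<open>velocity_eq\<close>).
\<close>

definition velocity :: "(nat \<Rightarrow> nat \<Rightarrow> real) \<Rightarrow> real \<Rightarrow> real^3" where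
  "velocity d t =
     tetra_dir ((LEAST m. switching_time d m \<le> t \<and> t < switching_time d (Suc m)) mod 4 + 1)"

definition position :: "real \<Rightarrow> (nat \<Rightarrow> nat \<Rightarrow> real) \<Rightarrow> real \<Rightarrow> real^3" where
  "position c d t = c *\<^sub>R (LINT s:{0..t}|lborel. velocity d s)"

lemma switching_time_mono:
  assumes "\<And>j k. j \<in> {1..4} \<Longrightarrow> 1 \<le> k \<Longrightarrow> 0 \<le> d j k" and "m \<le> m'"
  shows "switching_time d m \<le> switching_time d m'"
proof -
  have "switching_time d m \<le> switching_time d (Suc m)" for m
  proof -
    define n j where "n = m div 4" and "j = m mod 4 + 1"
    have Suc: "Suc m = 4 * n + j" and j: "1 \<le> j" "j \<le> 4"
      unfolding n_def j_def using mod_less_divisor[of 4 m] by simp_all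
    have dm: "m mod 4 = j - 1" "m div 4 = n" by (simp_all add: n_def j_def)
    have "j = 1 \<or> j = 2 \<or> j = 3 \<or> j = 4" using j by linarith
    then have "switching_time d (Suc m) - switching_time d m = d j (n + 1)"
      unfolding Suc switching_time_cycle[OF j]
      unfolding switching_time_def dm
      by (elim disjE) (simp_all add: total_duration_def numeral_eq_Suc)
    moreover have "0 \<le> d j (n + 1)" using assms(1) j by simp
    ultimately show ?thesis by simp
  qed
  then show ?thesis using assms(2) by (rule lift_Suc_mono_le)
qed

lemma velocity_eq:
  assumes nonneg: "\<And>j k. j \<in> {1..4} \<Longrightarrow> 1 \<le> k \<Longrightarrow> 0 \<le> d j k"
    and j: "1 \<le> j" "j \<le> 4"
    and t: "switching_time d (4 * n + j - 1) \<le> t" "t < switching_time d (4 * n + j)"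
  shows "velocity d t = tetra_dir j"
proof -
  have "(LEAST m. switching_time d m \<le> t \<and> t < switching_time d (Suc m)) = 4 * n + j - 1"
  proof (rule Least_equality)
    show "switching_time d (4 * n + j - 1) \<le> t \<and> t < switching_time d (Suc (4 * n + j - 1))"
      using t j by simp
  next
    fix m assume m: "switching_time d m \<le> t \<and> t < switching_time d (Suc m)"
    show "4 * n + j - 1 \<le> m"
    proof (rule ccontr)
      assume "\<not> 4 * n + j - 1 \<le> m"
      then have "switching_time d (Suc m) \<le> switching_time d (4 * n + j - 1)"
        by (intro switching_time_mono nonneg) auto
      with m t show False by simp
    qed
  qed
  moreover obtain i where "j = Suc i" "i < 4" using j by (cases j) auto
  then have "(4 * n + j - 1) mod 4 + 1 = j" by simp
  ultimately show ?thesis by (simp add: velocity_def)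
qed


section \<open>Densities\<close>

text \<open>
  \<open>f\<close> is the continuous density on the open tetrahedron of the sub-probability law of the
  position at time \<open>t\<close> on the event that the direction is then the \<open>j\<close>-th one, under the
  conditional probability given the initial state.
\<close>

definition is_direction_density ::
    "'a measure \<Rightarrow> real \<Rightarrow> (nat \<Rightarrow> nat \<Rightarrow> 'a \<Rightarrow> real) \<Rightarrow> nat \<Rightarrow> real \<Rightarrow> (real^3 \<Rightarrow> real) \<Rightarrow> bool" where
  "is_direction_density M c D j t f \<longleftrightarrow>
     continuous_on (interior (tetrahedron c t)) f \<and>
     (\<forall>B \<in> sets borel. B \<subseteq> interior (tetrahedron c t) \<longrightarrow>
        set_integrable lborel B f \<and>
        \<P>(\<omega> in M. position c (\<lambda>j k. D j k \<omega>) t \<in> B \<and> velocity (\<lambda>j k. D j k \<omega>) t = tetra_dir j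
            \<bar> position c (\<lambda>j k. D j k \<omega>) 0 = 0 \<and> velocity (\<lambda>j k. D j k \<omega>) 0 = tetra_dir 1)
          = (LINT x:B|lborel. f x))"

end

theory Submission imports Defs begin

text \<open>
  The occupation times of the four directions are the barycentric coordinates of the position, hence
  affine functions of it with coefficients of order one: for the position at time \<open>t\<close> to be within
  \<open>r\<close> of a fixed point, each of them must lie within a constant times \<open>r\<close> of a value close to
  \<open>t / 4\<close>. Apart from the current direction, each occupation time is an arrival time of the
  corresponding counting process (\<open>durations_of_position_in_ball\<close>). The directions other than the
  current one are three, as many as the dimension of the space.

  For a geometric counting process the \<open>n\<close>-th arrival time has the distribution function
  \<open>(l * s / (1 + l * s)) ^ n\<close> (\<open>gcp_arrival_cdf\<close>). This has two consequences. The density of an arrival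
  time at \<open>u\<close> is at most \<open>1 / u\<close>, uniformly in \<open>n\<close> (\<open>gcp_arrival_window\<close>), so by independence three
  of them are in the prescribed windows with probability at most a constant times \<open>(r / t) ^ 3\<close>.
  Moreover the probability that the current direction has completed \<open>n\<close> displacements by time \<open>t\<close> is
  geometric in \<open>n\<close>, and the sum over \<open>n\<close> is of order \<open>t\<close>.

  Thus a ball of radius \<open>r\<close> around a fixed point is hit at time \<open>t\<close> with probability at most a
  constant times \<open>r ^ 3 / t\<^sup>2\<close> (\<open>position_in_ball_bound\<close>). Dividing by the volume of the ball and
  letting \<open>r\<close> tend to 0, the continuous densities are at most a constant times \<open>1 / t\<^sup>2\<close> at that point.
\<close>

section \<open>Geometry of the directions\<close>

lemma tetra_dir_inner:
  assumes "i \<in> {1..4}" "j \<in> {1..4}"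
  shows "tetra_dir i \<bullet> tetra_dir j = (if i = j then 1 else - 1/3)"
proof -
  have "i = 1 \<or> i = 2 \<or> i = 3 \<or> i = 4" "j = 1 \<or> j = 2 \<or> j = 3 \<or> j = 4"
    using assms by auto
  then show ?thesis
    by (elim disjE) (simp_all add: tetra_dir_def inner_vec_def sum_3 field_simps)
qed

lemma sum_tetra_dir: "(\<Sum>i=1..4. tetra_dir i) = 0"
  by (simp add: numeral_eq_Suc) (simp add: tetra_dir_def vec_eq_iff forall_3)

text \<open>
  The four directions form a tight frame. This inverts the barycentric coordinates: it recovers
  a point from its inner products with the directions.
\<close>

lemma tetra_dir_frame: "(\<Sum>i=1..4. (y \<bullet> tetra_dir i) *\<^sub>R tetra_dir i) = (4/3) *\<^sub>R y"
proof -
  have "{1..4::nat} = {1,2,3,4}" by auto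
  then show ?thesis
  by (simp add: tetra_dir_def vec_eq_iff forall_3 inner_vec_def sum_3 field_simps)
qed

text \<open>
  Barycentric coordinates. Taking the inner product of \<open>y\<close> with \<open>tetra_dir i\<close> isolates
  \<open>s i\<close>, because the other three directions contribute \<open>- 1/3\<close> times the remaining time
  \<open>t - s i\<close>. So the position at time \<open>t\<close> determines how long the particle has moved in each
  direction.
\<close>

lemma occupation_from_position:
  fixes s :: "nat \<Rightarrow> real"
  assumes "(\<Sum>i=1..4. s i) = t" "c > 0" "i \<in> {1..4}"
    and "y = c *\<^sub>R (\<Sum>i=1..4. s i *\<^sub>R tetra_dir i)"
  shows "s i = t / 4 + 3 / (4 * c) * (y \<bullet> tetra_dir i)"
proof -
  have "y \<bullet> tetra_dir i = c * (\<Sum>k=1..4. s k * (tetra_dir k \<bullet> tetra_dir i))"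
    by (simp add: assms(4) inner_sum_left)
  also have "(\<Sum>k=1..4. s k * (tetra_dir k \<bullet> tetra_dir i))
      = (\<Sum>k=1..4. (if k = i then 4/3 * s i else 0) - s k / 3)"
    using assms(3) by (intro sum.cong refl) (simp add: tetra_dir_inner)
  also have "\<dots> = 4/3 * s i - t / 3"
    using assms(1,3) by (simp add: sum_subtractf flip: sum_divide_distrib)
  finally show ?thesis using assms(2) by (simp add: field_simps)
qed

text \<open>
  The inradius of the tetrahedron is one third of its circumradius \<open>c * t\<close>; the weights \<open>a i\<close>
  in the proof are the normalised barycentric coordinates of \<open>y\<close>.
\<close>

lemma ball_subset_tetrahedron:
  assumes "c > 0" "t > 0"
  shows "ball 0 (c * t / 3) \<subseteq> tetrahedron c t"
proof
  fix y :: "real^3" assume y: "y \<in> ball 0 (c * t / 3)"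
  define a where "a i = 1 / 4 + 3 / (4 * c * t) * (y \<bullet> tetra_dir i)" for i
  have nn: "a i \<ge> 0" if i: "i \<in> {1..4}" for i
  proof -
    have "norm (tetra_dir i) = 1" using tetra_dir_inner[OF i i] by (simp add: norm_eq_1)
    then have "\<bar>y \<bullet> tetra_dir i\<bar> \<le> norm y" using Cauchy_Schwarz_ineq2[of y "tetra_dir i"] by simp
    then have "y \<bullet> tetra_dir i \<ge> - (c * t / 3)" using y by simp
    then show ?thesis using assms by (simp add: a_def field_simps)
  qed
  have sum1: "(\<Sum>i=1..4. a i) = 1"
    unfolding a_def sum.distrib sum_distrib_left[symmetric] inner_sum_right[symmetric] sum_tetra_dir
    by simp
  have "(\<Sum>i=1..4. a i *\<^sub>R ((c * t) *\<^sub>R tetra_dir i))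
      = (c * t) *\<^sub>R ((1/4) *\<^sub>R (\<Sum>i=1..4. tetra_dir i)
          + (3 / (4 * c * t)) *\<^sub>R (\<Sum>i=1..4. (y \<bullet> tetra_dir i) *\<^sub>R tetra_dir i))"
    by (simp add: a_def algebra_simps sum.distrib scaleR_sum_right)
  also have "\<dots> = y" using assms unfolding tetra_dir_frame sum_tetra_dir by simp
  finally have y_eq: "(\<Sum>i=1..4. a i *\<^sub>R ((c * t) *\<^sub>R tetra_dir i)) = y" .
  have "(\<Sum>i=1..4. a i *\<^sub>R ((c * t) *\<^sub>R tetra_dir i)) \<in> tetrahedron c t"
    unfolding tetrahedron_def by (rule convex_sum) (use sum1 nn in \<open>auto intro!: hull_inc\<close>)
  then show "y \<in> tetrahedron c t" unfolding y_eq .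
qed

section \<open>Position in terms of arrival times\<close>

text \<open>
  The number of completed displacements in direction \<open>r\<close> at the \<open>m\<close>-th switching time. It
  gives all four directions the same formula, without reference to the position inside the cycle.
\<close>

definition completed :: "nat \<Rightarrow> nat \<Rightarrow> nat" where
  "completed m r = (m + 4 - r) div 4"

lemma completed_cycle:
  assumes "j \<in> {1..4}" "r \<in> {1..4}"
  shows "completed (4 * n + j - 1) r = (if r < j then n + 1 else n)"
proof -
  have "j = 1 \<or> j = 2 \<or> j = 3 \<or> j = 4" "r = 1 \<or> r = 2 \<or> r = 3 \<or> r = 4"
    using assms by auto
  then show ?thesis by (elim disjE) (simp_all add: completed_def)
qed

lemma index_as_cycle:
  obtains n j where "j \<in> {1..4}" "m = 4 * n + j - (1::nat)" "m mod 4 + 1 = j"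
proof
  show "m mod 4 + 1 \<in> {1..4}" using mod_less_divisor[of 4 m] by simp
  show "m = 4 * (m div 4) + (m mod 4 + 1) - 1" by simp
qed simp

lemma completed_Suc:
  assumes "r \<in> {1..4}"
  shows "completed (Suc m) r = completed m r + (if r = m mod 4 + 1 then 1 else 0)"
proof -
  obtain n j where j: "j \<in> {1..4}" "m = 4 * n + j - 1" "m mod 4 + 1 = j"
    by (rule index_as_cycle)
  show ?thesis
  proof (cases "j = 4")
    case True
    then have "Suc m = 4 * (n + 1) + 1 - 1" using j by simp
    then have "completed (Suc m) r = n + 1"
      using completed_cycle[of 1 r "n + 1"] assms by simp
    then show ?thesis using completed_cycle[of j r n] j assms True by auto
  next
    case False
    then have "Suc m = 4 * n + (j + 1) - 1" "j + 1 \<in> {1..4}" using j by auto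
    then have "completed (Suc m) r = (if r < j + 1 then n + 1 else n)"
      using completed_cycle[of "j + 1" r n] assms by simp
    then show ?thesis using completed_cycle[of j r n] j assms by auto
  qed
qed

lemma switching_time_eq_sum_completed:
  "switching_time d m = (\<Sum>r=1..4. total_duration d r (completed m r))"
proof -
  define n i where "n = m div 4" and "i = m mod 4"
  have i: "i < 4" "m = 4 * n + (i + 1) - 1" by (simp_all add: n_def i_def)
  have "{1..4} = {1..i} \<union> {i + 1..4}" using i by auto
  then have "(\<Sum>r=1..4. total_duration d r (completed m r))
     = (\<Sum>r=1..i. total_duration d r (completed m r)) + (\<Sum>r=i+1..4. total_duration d r (completed m r))"
    by (simp add: sum.union_disjoint)
  also have "\<dots> = (\<Sum>r=1..i. total_duration d r (n + 1)) + (\<Sum>r=i+1..4. total_duration d r n)"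
    using i(1) completed_cycle[of "i + 1" _ n]
    by (intro arg_cong2[where f = "(+)"] sum.cong refl) (simp_all add: i(2))
  finally show ?thesis by (simp add: switching_time_def n_def i_def)
qed

lemma sum_completed_Suc:
  fixes f :: "nat \<Rightarrow> real^3"
  shows "(\<Sum>r=1..4. total_duration d r (completed (Suc m) r) *\<^sub>R f r)
    = (\<Sum>r=1..4. total_duration d r (completed m r) *\<^sub>R f r)
      + (switching_time d (Suc m) - switching_time d m) *\<^sub>R f (m mod 4 + 1)"
proof -
  define j where "j = m mod 4 + 1"
  have j: "j \<in> {1..4}" using mod_less_divisor[of 4 m] by (simp add: j_def)
  define e where "e = d j (Suc (completed m j))"
  have *: "total_duration d r (completed (Suc m) r)
      = total_duration d r (completed m r) + (if r = j then e else 0)" if "r \<in> {1..4}" for r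
    using completed_Suc[OF that, of m] by (simp add: total_duration_def e_def j_def)
  have "switching_time d (Suc m) = switching_time d m + e"
    using j by (simp add: switching_time_eq_sum_completed * sum.distrib)
  moreover have "(\<Sum>r=1..4. total_duration d r (completed (Suc m) r) *\<^sub>R f r)
     = (\<Sum>r=1..4. total_duration d r (completed m r) *\<^sub>R f r + (if r = j then e *\<^sub>R f j else 0))"
    by (intro sum.cong refl) (simp add: * scaleR_add_left)
  ultimately show ?thesis using j by (simp add: sum.distrib j_def)
qed

lemma velocity_on_interval:
  assumes "\<And>j k. j \<in> {1..4} \<Longrightarrow> 1 \<le> k \<Longrightarrow> 0 \<le> d j k"
    and "switching_time d m \<le> t" "t < switching_time d (Suc m)"
  shows "velocity d t = tetra_dir (m mod 4 + 1)"
proof -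
  obtain n j where j: "j \<in> {1..4}" "m = 4 * n + j - 1" "m mod 4 + 1 = j"
    by (rule index_as_cycle)
  then have "Suc m = 4 * n + j" by auto
  then show ?thesis using velocity_eq[of d j n t] assms j by auto
qed

text \<open>
  Half-open intervals are used because the velocity is only known to be constant before the next
  switch, and because consecutive ones are disjoint.
\<close>

lemma has_bochner_integral_velocity_step:
  assumes nonneg: "\<And>j k. j \<in> {1..4} \<Longrightarrow> 1 \<le> k \<Longrightarrow> 0 \<le> d j k"
    and up_to: "has_bochner_integral lborel (\<lambda>s. indicator {0..<switching_time d m} s *\<^sub>R velocity d s) a"
    and t: "switching_time d m \<le> t" "t \<le> switching_time d (Suc m)"
  shows "has_bochner_integral lborel (\<lambda>s. indicator {0..<t} s *\<^sub>R velocity d s)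
           (a + (t - switching_time d m) *\<^sub>R tetra_dir (m mod 4 + 1))"
proof -
  let ?T = "switching_time d m"
  have T0: "0 \<le> ?T" using switching_time_mono[of d 0 m] nonneg by (simp add: switching_time_0)
  have "has_bochner_integral lborel (\<lambda>s. indicator {?T..<t} s *\<^sub>R tetra_dir (m mod 4 + 1))
          ((t - ?T) *\<^sub>R tetra_dir (m mod 4 + 1))"
    using t(1) has_bochner_integral_real_indicator[of "{?T..<t}" lborel]
    by (intro has_bochner_integral_scaleR_left) simp_all
  from has_bochner_integral_add[OF up_to this]
  have *: "has_bochner_integral lborel
      (\<lambda>s. indicator {0..<?T} s *\<^sub>R velocity d s + indicator {?T..<t} s *\<^sub>R tetra_dir (m mod 4 + 1))
      (a + (t - ?T) *\<^sub>R tetra_dir (m mod 4 + 1))" .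
  have "(\<lambda>s. indicator {0..<t} s *\<^sub>R velocity d s) =
      (\<lambda>s. indicator {0..<?T} s *\<^sub>R velocity d s + indicator {?T..<t} s *\<^sub>R tetra_dir (m mod 4 + 1))"
  proof
    fix s
    show "indicator {0..<t} s *\<^sub>R velocity d s =
      indicator {0..<?T} s *\<^sub>R velocity d s + indicator {?T..<t} s *\<^sub>R tetra_dir (m mod 4 + 1)"
    proof (cases "?T \<le> s \<and> s < t")
      case True
      then have "velocity d s = tetra_dir (m mod 4 + 1)"
        using t by (intro velocity_on_interval nonneg) auto
      with True T0 show ?thesis by simp
    next
      case False
      with t(1) have "s \<in> {0..<t} \<longleftrightarrow> s \<in> {0..<?T}" by auto
      with False show ?thesis by (simp add: indicator_def)
    qed
  qed
  with * show ?thesis by simp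
qed

lemma position_eq:
  assumes nonneg: "\<And>j k. j \<in> {1..4} \<Longrightarrow> 1 \<le> k \<Longrightarrow> 0 \<le> d j k"
    and t: "switching_time d m \<le> t" "t \<le> switching_time d (Suc m)"
  shows "position c d t = c *\<^sub>R ((\<Sum>r=1..4. total_duration d r (completed m r) *\<^sub>R tetra_dir r)
           + (t - switching_time d m) *\<^sub>R tetra_dir (m mod 4 + 1))"
proof -
  have at_switch: "has_bochner_integral lborel (\<lambda>s. indicator {0..<switching_time d m} s *\<^sub>R velocity d s)
      (\<Sum>r=1..4. total_duration d r (completed m r) *\<^sub>R tetra_dir r)" for m
  proof (induction m)
    case 0
    have "(\<Sum>r=1..4. total_duration d r (completed 0 r) *\<^sub>R tetra_dir r) = 0"
      by (intro sum.neutral ballI) (simp add: completed_def total_duration_def)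
    then show ?case
      unfolding switching_time_0 by (simp add: has_bochner_integral_zero)
  next
    case (Suc m)
    show ?case unfolding sum_completed_Suc
      using nonneg by (intro has_bochner_integral_velocity_step Suc switching_time_mono) auto
  qed
  \<comment> \<open>the missing end point of the closed interval carries no mass\<close>
  have "has_bochner_integral lborel (\<lambda>s. indicator {t} s *\<^sub>R velocity d t) (0 *\<^sub>R velocity d t)"
    using has_bochner_integral_real_indicator[of "{t}" lborel]
    by (intro has_bochner_integral_scaleR_left) simp_all
  from has_bochner_integral_add[OF has_bochner_integral_velocity_step[OF nonneg at_switch t] this]
  have "(LINT s|lborel. indicator {0..<t} s *\<^sub>R velocity d s + indicator {t} s *\<^sub>R velocity d t)
     = (\<Sum>r=1..4. total_duration d r (completed m r) *\<^sub>R tetra_dir r)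
           + (t - switching_time d m) *\<^sub>R tetra_dir (m mod 4 + 1)"
    by (simp add: has_bochner_integral_integral_eq)
  moreover have "0 \<le> t"
    using t(1) switching_time_mono[of d 0 m] nonneg by (simp add: switching_time_0)
  then have "(\<lambda>s. indicator {0..<t} s *\<^sub>R velocity d s + indicator {t} s *\<^sub>R velocity d t)
      = (\<lambda>s. indicator {0..t} s *\<^sub>R velocity d s)"
    by (auto simp: fun_eq_iff indicator_def)
  ultimately show ?thesis by (simp add: position_def set_lebesgue_integral_def)
qed

text \<open>
  If the particle is in a small ball at time \<open>t\<close>, then the three directions other than the current
  one have been occupied for a whole number of completed displacements, so three arrival times are
  confined to windows of width proportional to \<open>r\<close>, at a bounded distance from \<open>t / 4\<close> when \<open>x\<close>
  is fixed. For the current direction only \<open>\<le> t\<close> is retained, which decouples the four clocks.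
\<close>

lemma durations_of_position_in_ball:
  assumes nonneg: "\<And>j k. j \<in> {1..4} \<Longrightarrow> 1 \<le> k \<Longrightarrow> 0 \<le> d j k"
    and t: "switching_time d m \<le> t" "t \<le> switching_time d (Suc m)"
    and c: "c > 0" and ball: "position c d t \<in> ball x r"
  defines "u \<equiv> \<lambda>i. t / 4 + 3 / (4 * c) * (x \<bullet> tetra_dir i - r)"
  shows "\<And>i. i \<in> {1..4} - {m mod 4 + 1} \<Longrightarrow>
           total_duration d i (completed m i) \<in> {u i<..u i + 3 * r / (2 * c)}"
    and "total_duration d (m mod 4 + 1) (completed m (m mod 4 + 1)) \<le> t"
proof -
  define j where "j = m mod 4 + 1"
  have j: "j \<in> {1..4}" using mod_less_divisor[of 4 m] by (simp add: j_def)
  \<comment> \<open>the times spent in each direction up to time \<open>t\<close>\<close>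
  define s where "s i = total_duration d i (completed m i) + (if i = j then t - switching_time d m else 0)" for i
  have sum_s: "(\<Sum>i=1..4. s i) = t"
    using j by (simp add: s_def sum.distrib switching_time_eq_sum_completed)
  have "(\<Sum>i=1..4. s i *\<^sub>R tetra_dir i) = (\<Sum>i=1..4. total_duration d i (completed m i) *\<^sub>R tetra_dir i
      + (if i = j then (t - switching_time d m) *\<^sub>R tetra_dir j else 0))"
    by (intro sum.cong refl) (simp add: s_def scaleR_add_left)
  then have pos: "position c d t = c *\<^sub>R (\<Sum>i=1..4. s i *\<^sub>R tetra_dir i)"
    using j position_eq[OF nonneg t] by (simp add: sum.distrib j_def)
  show "total_duration d i (completed m i) \<in> {u i<..u i + 3 * r / (2 * c)}"
    if "i \<in> {1..4} - {m mod 4 + 1}" for i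
  proof -
    from that have i: "i \<in> {1..4}" "i \<noteq> j" by (auto simp: j_def)
    have "norm (tetra_dir i) = 1" using tetra_dir_inner[OF i(1) i(1)] by (simp add: norm_eq_1)
    then have "\<bar>(position c d t - x) \<bullet> tetra_dir i\<bar> < r"
      using Cauchy_Schwarz_ineq2[of "position c d t - x" "tetra_dir i"] ball
      by (simp add: dist_norm norm_minus_commute)
    then have "\<bar>position c d t \<bullet> tetra_dir i - x \<bullet> tetra_dir i\<bar> < r" by (simp add: inner_diff_left)
    moreover have "total_duration d i (completed m i)
        = t / 4 + 3 / (4 * c) * (position c d t \<bullet> tetra_dir i)"
      using occupation_from_position[OF sum_s c i(1) pos] i(2) by (simp add: s_def)
    ultimately show ?thesis using c by (simp add: u_def field_simps abs_less_iff)
  qed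
  have "total_duration d j (completed m j) \<le> switching_time d m"
    unfolding switching_time_eq_sum_completed using j nonneg
    by (intro member_le_sum) (auto simp: total_duration_def intro!: sum_nonneg)
  then show "total_duration d (m mod 4 + 1) (completed m (m mod 4 + 1)) \<le> t"
    using t by (simp add: j_def)
qed

section \<open>Arrival times of a geometric counting process\<close>

abbreviation exponential_measure :: "real \<Rightarrow> real measure" where
  "exponential_measure a \<equiv> density lborel (exponential_density a)"

lemma emeasure_exponential_scale:
  assumes "a > 0" and [measurable]: "B \<in> sets borel"
  shows "emeasure (exponential_measure a) B
       = emeasure (exponential_measure 1) {e. e / a \<in> B}"
proof -
  have "emeasure (exponential_measure 1) {e. e / a \<in> B}
      = (\<integral>\<^sup>+e. ennreal (exponential_density 1 e) * indicator {e. e / a \<in> B} e \<partial>lborel)"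
    by (subst emeasure_density) auto
  also have "\<dots> = ennreal a * (\<integral>\<^sup>+s. ennreal (exponential_density 1 (a * s)) * indicator {e. e / a \<in> B} (a * s) \<partial>lborel)"
    using assms(1) by (subst nn_integral_real_affine[of _ a 0]) auto
  also have "\<dots> = (\<integral>\<^sup>+s. ennreal a * (ennreal (exponential_density 1 (a * s)) * indicator {e. e / a \<in> B} (a * s)) \<partial>lborel)"
    by (subst nn_integral_cmult) auto
  also have "\<dots> = (\<integral>\<^sup>+s. ennreal (exponential_density a s) * indicator B s \<partial>lborel)"
    using assms(1)
    by (intro nn_integral_cong)
       (auto simp: exponential_density_def indicator_def ennreal_mult' mult_less_0_iff mult.commute)
  also have "\<dots> = emeasure (exponential_measure a) B"
    by (subst emeasure_density) auto
  finally show ?thesis ..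
qed

lemma AE_exponential_measure_pos: "AE a in exponential_measure m. 0 < a"
proof -
  have "AE a in lborel. a \<noteq> (0::real)" by (rule AE_lborel_singleton)
  then have "AE a in lborel. 0 < ennreal (exponential_density m a) \<longrightarrow> 0 < a"
    by eventually_elim (auto simp: exponential_density_def split: if_splits)
  then show ?thesis by (subst AE_density) auto
qed

text \<open>
  Taking expectations in the definition removes the conditional expectation; writing the
  exponential law of rate \<open>a\<close> as a scaled standard one makes the integrand a product of sections of
  fixed sets, which is measurable in \<open>a\<close>.
\<close>

lemma mixed_poisson_rectangle:
  assumes "prob_space M" and m: "m > 0"
    and dist: "distributed M lborel \<alpha> (exponential_density m)"
    and mix: "mixed_poisson_interarrivals M \<alpha> D"
    and K: "finite K" "K \<subseteq> {1..}" and B: "\<And>k. k \<in> K \<Longrightarrow> B k \<in> sets borel"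
  shows "emeasure M {\<omega> \<in> space M. \<forall>k\<in>K. D k \<omega> \<in> B k}
      = (\<integral>\<^sup>+a. (\<Prod>k\<in>K. emeasure (exponential_measure 1) {e. e / a \<in> B k}) \<partial>exponential_measure m)"
proof -
  interpret prob_space M by fact
  interpret E: prob_space "exponential_measure 1" by (rule prob_space_exponential_density) simp
  let ?A = "{\<omega> \<in> space M. \<forall>k\<in>K. D k \<omega> \<in> B k}"
  let ?F = "vimage_algebra (space M) \<alpha> borel"
  have \<alpha>[measurable]: "\<alpha> \<in> borel_measurable M" using mix by (simp add: mixed_poisson_interarrivals_def)
  have [measurable]: "D k \<in> borel_measurable M" if "k \<in> K" for k
    using mix that K(2) by (auto simp: mixed_poisson_interarrivals_def)
  note B[measurable]
  have A[measurable]: "?A \<in> sets M" using K(1) by measurable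
  have "subalgebra M ?F"
    using measurable_sets[OF \<alpha>] by (auto simp: subalgebra_def sets_vimage_algebra2)
  then interpret finite_measure_subalgebra M ?F
    by unfold_locales
  define g where "g a = (\<Prod>k\<in>K. emeasure (exponential_measure 1) {e. e / a \<in> B k})" for a
  have g_meas[measurable]: "g \<in> borel_measurable borel"
  proof -
    have "(\<lambda>a. emeasure (exponential_measure 1) {e. e / a \<in> B k}) \<in> borel_measurable borel" if [measurable]: "k \<in> K" for k
    proof -
      have "Measurable.pred (borel \<Otimes>\<^sub>M exponential_measure 1) (\<lambda>x. snd x / fst x \<in> B k)"
        by measurable
      then have "{x \<in> space (borel \<Otimes>\<^sub>M exponential_measure 1). snd x / fst x \<in> B k} \<in> sets (borel \<Otimes>\<^sub>M exponential_measure 1)"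
        by (simp add: pred_def)
      from E.measurable_emeasure_Pair[OF this] show ?thesis
        by (simp add: vimage_def space_pair_measure)
    qed
    then show ?thesis unfolding g_def by measurable
  qed
  have g_fin: "g a \<le> 1" for a
    unfolding g_def by (intro prod_le_1) (auto simp: E.emeasure_le_1)
  have "AE \<omega> in M. 0 < \<alpha> \<omega>"
  proof -
    have "AE a in distr M lborel \<alpha>. 0 < a"
      unfolding distributed_distr_eq_density[OF dist] by (rule AE_exponential_measure_pos)
    then show ?thesis by (subst (asm) AE_distr_iff) auto
  qed
  moreover have "AE \<omega> in M. real_cond_exp M ?F (indicator ?A) \<omega> =
           (\<Prod>k\<in>K. measure (exponential_measure (\<alpha> \<omega>)) (B k))"
    using mix K B by (simp add: mixed_poisson_interarrivals_def)
  ultimately have AE: "AE \<omega> in M. ennreal (real_cond_exp M ?F (indicator ?A) \<omega>) = g (\<alpha> \<omega>)"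
  proof eventually_elim
    case (elim \<omega>)
    then have "ennreal (real_cond_exp M ?F (indicator ?A) \<omega>)
       = (\<Prod>k\<in>K. ennreal (measure (exponential_measure (\<alpha> \<omega>)) (B k)))"
      by (simp add: prod_ennreal)
    also have "\<dots> = g (\<alpha> \<omega>)" unfolding g_def
    proof (intro prod.cong refl)
      fix k assume k: "k \<in> K"
      interpret Ea: prob_space "exponential_measure (\<alpha> \<omega>)"
        using elim by (intro prob_space_exponential_density)
      show "ennreal (measure (exponential_measure (\<alpha> \<omega>)) (B k)) = emeasure (exponential_measure 1) {e. e / \<alpha> \<omega> \<in> B k}"
        using emeasure_exponential_scale[OF elim(1) B[OF k]] by (simp flip: Ea.emeasure_eq_measure)
    qed
    finally show ?case .
  qed
  have int: "integrable M (indicator ?A :: _ \<Rightarrow> real)"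
    using A by (intro integrable_real_indicator) (simp_all add: less_top[symmetric])
  have "emeasure M ?A = ennreal (\<integral>\<omega>. indicator ?A \<omega> \<partial>M)"
    by (simp add: emeasure_eq_measure)
  also have "\<dots> = ennreal (\<integral>\<omega>. real_cond_exp M ?F (indicator ?A) \<omega> \<partial>M)"
    using real_cond_exp_int(2)[OF int] by simp
  also have "\<dots> = (\<integral>\<^sup>+\<omega>. ennreal (real_cond_exp M ?F (indicator ?A) \<omega>) \<partial>M)"
  proof (rule nn_integral_eq_integral[symmetric])
    show "integrable M (real_cond_exp M ?F (indicator ?A))" using real_cond_exp_int(1)[OF int] .
    show "AE \<omega> in M. 0 \<le> real_cond_exp M ?F (indicator ?A) \<omega>" by (rule real_cond_exp_pos) auto
  qed
  also have "\<dots> = (\<integral>\<^sup>+\<omega>. g (\<alpha> \<omega>) \<partial>M)" using AE by (rule nn_integral_cong_AE)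
  also have "\<dots> = (\<integral>\<^sup>+a. g a \<partial>distr M lborel \<alpha>)" by (subst nn_integral_distr) auto
  also have "\<dots> = (\<integral>\<^sup>+a. g a \<partial>exponential_measure m)" using distributed_distr_eq_density[OF dist] by simp
  finally show ?thesis by (simp add: g_def)
qed

text \<open>
  A mixed Poisson sequence has the law of \<open>e k / a\<close> with \<open>e\<close> i.i.d. standard exponential and
  \<open>a\<close> independent of them. On this product space the conditioning on the intensity becomes Fubini's
  theorem.
\<close>

lemma mixed_poisson_law:
  assumes "prob_space M" and m: "m > 0"
    and dist: "distributed M lborel \<alpha> (exponential_density m)"
    and mix: "mixed_poisson_interarrivals M \<alpha> D"
    and K: "finite K" "K \<subseteq> {1..}"
  shows "distr M (\<Pi>\<^sub>M k\<in>K. borel) (\<lambda>\<omega>. \<lambda>k\<in>K. D k \<omega>)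
       = distr ((\<Pi>\<^sub>M k\<in>K. exponential_measure 1) \<Otimes>\<^sub>M exponential_measure m)
           (\<Pi>\<^sub>M k\<in>K. borel) (\<lambda>x. \<lambda>k\<in>K. fst x k / snd x)"
    (is "?P = ?Q")
proof (rule measure_eqI_PiM_finite[OF K(1), where M = "\<lambda>_. borel"])
  interpret M: prob_space M by fact
  have [measurable]: "D k \<in> borel_measurable M" if "k \<in> K" for k
    using mix that K(2) by (auto simp: mixed_poisson_interarrivals_def)
  have f: "(\<lambda>\<omega>. \<lambda>k\<in>K. D k \<omega>) \<in> M \<rightarrow>\<^sub>M (\<Pi>\<^sub>M k\<in>K. borel)"
    by measurable
  show "sets ?P = sets (\<Pi>\<^sub>M k\<in>K. borel)" "sets ?Q = sets (\<Pi>\<^sub>M k\<in>K. borel)" by simp_all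
  show "range (\<lambda>_::nat. \<Pi>\<^sub>E k\<in>K. (UNIV::real set)) \<subseteq> prod_algebra K (\<lambda>_. borel)"
    using K(1) by (auto intro!: prod_algebraI_finite)
  show "(\<Union>i::nat. \<Pi>\<^sub>E k\<in>K. (UNIV::real set)) = space (\<Pi>\<^sub>M k\<in>K. borel)" by (simp add: space_PiM)
  interpret D: prob_space ?P using f by (rule M.prob_space_distr)
  show "emeasure ?P (\<Pi>\<^sub>E k\<in>K. (UNIV::real set)) \<noteq> \<infinity>" for i :: nat by simp
next
  interpret E: prob_space "exponential_measure 1" by (rule prob_space_exponential_density) simp
  interpret Em: prob_space "exponential_measure m" by (rule prob_space_exponential_density) fact
  interpret PE: product_prob_space "\<lambda>_. exponential_measure 1" K by unfold_locales
  interpret P: pair_prob_space "\<Pi>\<^sub>M k\<in>K. exponential_measure 1" "exponential_measure m" by unfold_locales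
  fix B :: "nat \<Rightarrow> real set" assume B[measurable]: "\<And>k. k \<in> K \<Longrightarrow> B k \<in> sets borel"
  have [measurable]: "D k \<in> borel_measurable M" if "k \<in> K" for k
    using mix that K(2) by (auto simp: mixed_poisson_interarrivals_def)
  have PiB[measurable]: "Pi\<^sub>E K B \<in> sets (\<Pi>\<^sub>M k\<in>K. borel)" using K(1) B by (intro sets_PiM_I_finite) auto
  have g[measurable]: "(\<lambda>x. \<lambda>k\<in>K. fst x k / snd x)
      \<in> (\<Pi>\<^sub>M k\<in>K. exponential_measure 1) \<Otimes>\<^sub>M exponential_measure m \<rightarrow>\<^sub>M (\<Pi>\<^sub>M k\<in>K. borel)"
    by (rule measurable_restrict) measurable
  let ?S = "(\<lambda>x. \<lambda>k\<in>K. fst x k / snd x) -` Pi\<^sub>E K B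
      \<inter> space ((\<Pi>\<^sub>M k\<in>K. exponential_measure 1) \<Otimes>\<^sub>M exponential_measure m)"
  have "emeasure ?P (Pi\<^sub>E K B) = emeasure M {\<omega> \<in> space M. \<forall>k\<in>K. D k \<omega> \<in> B k}"
    by (subst emeasure_distr) (auto intro!: arg_cong2[where f = emeasure] simp: PiE_iff)
  also have "\<dots> = (\<integral>\<^sup>+a. (\<Prod>k\<in>K. emeasure (exponential_measure 1) {e. e / a \<in> B k}) \<partial>exponential_measure m)"
    by (rule mixed_poisson_rectangle) (use assms B in auto)
  also have "\<dots> = (\<integral>\<^sup>+a. emeasure (\<Pi>\<^sub>M k\<in>K. exponential_measure 1) ((\<lambda>e. (e, a)) -` ?S) \<partial>exponential_measure m)"
  proof (rule nn_integral_cong)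
    fix a :: real
    have "(\<lambda>e. (e, a)) -` ?S = (\<Pi>\<^sub>E k\<in>K. {e. e / a \<in> B k})"
      by (auto simp: space_pair_measure space_PiM PiE_iff extensional_def)
    moreover have "{e. e / a \<in> B k} \<in> sets (exponential_measure 1)" if [measurable]: "k \<in> K" for k
    proof -
      have "Measurable.pred borel (\<lambda>e. e / a \<in> B k)" by measurable
      then show ?thesis by (simp add: pred_def)
    qed
    ultimately show "(\<Prod>k\<in>K. emeasure (exponential_measure 1) {e. e / a \<in> B k})
        = emeasure (\<Pi>\<^sub>M k\<in>K. exponential_measure 1) ((\<lambda>e. (e, a)) -` ?S)"
      using K(1) by (simp add: PE.emeasure_PiM)
  qed
  also have "\<dots> = emeasure ((\<Pi>\<^sub>M k\<in>K. exponential_measure 1) \<Otimes>\<^sub>M exponential_measure m) ?S"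
    by (rule P.emeasure_pair_measure_alt2[symmetric]) (rule measurable_sets[OF g PiB])
  also have "\<dots> = emeasure ?Q (Pi\<^sub>E K B)"
    by (rule emeasure_distr[OF g PiB, symmetric])
  finally show "emeasure ?P (Pi\<^sub>E K B) = emeasure ?Q (Pi\<^sub>E K B)" .
qed

lemma exponential_measure_tail:
  assumes "m > 0" "0 \<le> g" "0 < s"
  shows "emeasure (exponential_measure m) {a. g / a \<le> s} = ennreal (exp (- (m / s) * g))"
proof -
  interpret prob_space "exponential_measure m" by (rule prob_space_exponential_density) fact
  have "AE a in lborel. a \<noteq> g / s" by (rule AE_lborel_singleton)
  then have "AE a in exponential_measure m. a \<noteq> g / s" by (subst AE_density) auto
  with AE_exponential_measure_pos
  have "AE a in exponential_measure m. a \<in> {a. g / a \<le> s} \<longleftrightarrow> a \<in> {a. g / s < a}"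
    by eventually_elim (use assms in \<open>auto simp: field_simps\<close>)
  then have "emeasure (exponential_measure m) {a. g / a \<le> s} = emeasure (exponential_measure m) {a. g / s < a}"
    by (rule emeasure_eq_AE) auto
  also have "\<dots> = ennreal (exp (- (g / s) * m))"
    using exponential_distributedD_gt[of "\<lambda>a. a" m "g / s"] assms
    by (simp add: emeasure_eq_measure distributed_def distr_id2)
  finally show ?thesis by (simp add: field_simps)
qed

text \<open>
  The factor \<open>exp (- q * e)\<close> turns the exponential density of rate \<open>1\<close> into \<open>1 / (1 + q)\<close>
  times the one of rate \<open>1 + q\<close>.
\<close>

lemma exponential_measure_laplace:
  assumes "0 \<le> q"
  shows "(\<integral>\<^sup>+e. ennreal (exp (- q * e)) \<partial>exponential_measure 1) = ennreal (1 / (1 + q))"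
proof -
  have "(\<integral>\<^sup>+e. ennreal (exp (- q * e)) \<partial>exponential_measure 1)
      = (\<integral>\<^sup>+e. ennreal (1 / (1 + q)) * ennreal (exponential_density (1 + q) e) \<partial>lborel)"
  proof (subst nn_integral_density)
    show "(\<integral>\<^sup>+e. ennreal (exponential_density 1 e) * ennreal (exp (- q * e)) \<partial>lborel)
      = (\<integral>\<^sup>+e. ennreal (1 / (1 + q)) * ennreal (exponential_density (1 + q) e) \<partial>lborel)"
    proof (rule nn_integral_cong)
      fix e :: real
      have "exponential_density 1 e * exp (- q * e) = 1 / (1 + q) * exponential_density (1 + q) e"
        using assms by (simp add: exponential_density_def algebra_simps flip: exp_add)
          (simp add: field_simps)
      then show "ennreal (exponential_density 1 e) * ennreal (exp (- q * e))
          = ennreal (1 / (1 + q)) * ennreal (exponential_density (1 + q) e)"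
        using assms by (simp add: exponential_density_nonneg flip: ennreal_mult)
    qed
  qed auto
  also have "\<dots> = ennreal (1 / (1 + q)) * emeasure (exponential_measure (1 + q)) UNIV"
    by (subst nn_integral_cmult) (auto simp: emeasure_density)
  also have "emeasure (exponential_measure (1 + q)) UNIV = 1"
    using prob_space.emeasure_space_1[OF prob_space_exponential_density[of "1 + q"]] assms by simp
  finally show ?thesis by simp
qed

text \<open>
  The counts of the process are geometric. On the product space the event is
  \<open>a \<ge> (e 1 + \<dots> + e n) / s\<close>. Integrating out the exponential \<open>a\<close> first leaves
  \<open>exp (- (m / s) * (e 1 + \<dots> + e n))\<close>, a product of functions of independent variables, each with
  mean \<open>1 / (1 + m / s)\<close>.
\<close>

lemma mixed_poisson_arrival_cdf:
  assumes "prob_space M" and m: "m > 0"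
    and dist: "distributed M lborel \<alpha> (exponential_density m)"
    and mix: "mixed_poisson_interarrivals M \<alpha> D"
    and s: "0 < s"
  shows "measure M {\<omega> \<in> space M. (\<Sum>k=1..n. D k \<omega>) \<le> s} = (s / (s + m)) ^ n"
proof -
  interpret M: prob_space M by fact
  interpret E: prob_space "exponential_measure 1" by (rule prob_space_exponential_density) simp
  interpret Em: prob_space "exponential_measure m" by (rule prob_space_exponential_density) fact
  interpret PE: product_prob_space "\<lambda>_. exponential_measure 1" "{1..n}" by unfold_locales
  interpret P: pair_prob_space "\<Pi>\<^sub>M k\<in>{1..n}. exponential_measure 1" "exponential_measure m" by unfold_locales
  let ?N = "(\<Pi>\<^sub>M k\<in>{1..n}. exponential_measure 1) \<Otimes>\<^sub>M exponential_measure m"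
  let ?\<phi> = "\<lambda>\<omega>. \<lambda>k\<in>{1..n}. D k \<omega>" and ?\<psi> = "\<lambda>x. \<lambda>k\<in>{1..n}. fst x k / (snd x :: real)"
  let ?B = "{z \<in> space (\<Pi>\<^sub>M k\<in>{1..n}. borel). (\<Sum>k=1..n. z k) \<le> s}"
  have [measurable]: "D k \<in> borel_measurable M" if "k \<in> {1..n}" for k
    using mix that by (auto simp: mixed_poisson_interarrivals_def)
  have [measurable]: "?\<phi> \<in> M \<rightarrow>\<^sub>M (\<Pi>\<^sub>M k\<in>{1..n}. borel)" by measurable
  have [measurable]: "?\<psi> \<in> ?N \<rightarrow>\<^sub>M (\<Pi>\<^sub>M k\<in>{1..n}. borel)"
    by (rule measurable_restrict) measurable
  have [measurable]: "?B \<in> sets (\<Pi>\<^sub>M k\<in>{1..n}. borel)" by measurable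
  have "emeasure M {\<omega> \<in> space M. (\<Sum>k=1..n. D k \<omega>) \<le> s} = emeasure (distr M (\<Pi>\<^sub>M k\<in>{1..n}. borel) ?\<phi>) ?B"
    by (subst emeasure_distr) (auto intro!: arg_cong2[where f = emeasure] simp: space_PiM)
  also have "\<dots> = emeasure (distr ?N (\<Pi>\<^sub>M k\<in>{1..n}. borel) ?\<psi>) ?B"
    by (subst mixed_poisson_law[OF assms(1) m dist mix]) auto
  also have "\<dots> = emeasure ?N (?\<psi> -` ?B \<inter> space ?N)"
    by (rule emeasure_distr) measurable
  also have "\<dots> = (\<integral>\<^sup>+e. emeasure (exponential_measure m) (Pair e -` (?\<psi> -` ?B \<inter> space ?N)) \<partial>(\<Pi>\<^sub>M k\<in>{1..n}. exponential_measure 1))"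
    by (rule Em.emeasure_pair_measure_alt) measurable
  also have "\<dots> = (\<integral>\<^sup>+e. (\<Prod>k\<in>{1..n}. ennreal (exp (- (m / s) * e k))) \<partial>(\<Pi>\<^sub>M k\<in>{1..n}. exponential_measure 1))"
  proof (rule nn_integral_cong_AE)
    have "AE e in (\<Pi>\<^sub>M k\<in>{1..n}. exponential_measure 1). \<forall>k\<in>{1..n}. 0 < e k"
      by (intro AE_finite_allI AE_PiM_component AE_exponential_measure_pos)
         (simp_all add: E.prob_space_axioms)
    then show "AE e in (\<Pi>\<^sub>M k\<in>{1..n}. exponential_measure 1).
        emeasure (exponential_measure m) (Pair e -` (?\<psi> -` ?B \<inter> space ?N))
        = (\<Prod>k\<in>{1..n}. ennreal (exp (- (m / s) * e k)))"
      using AE_space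
    proof eventually_elim
      case (elim e)
      then have "Pair e -` (?\<psi> -` ?B \<inter> space ?N) = {a. (\<Sum>k=1..n. e k) / a \<le> s}"
        by (auto simp: space_pair_measure space_PiM sum_divide_distrib)
      moreover have "0 \<le> (\<Sum>k=1..n. e k)" using elim by (intro sum_nonneg) (auto intro: less_imp_le)
      ultimately have "emeasure (exponential_measure m) (Pair e -` (?\<psi> -` ?B \<inter> space ?N))
          = ennreal (exp (- (m / s) * (\<Sum>k=1..n. e k)))"
        using exponential_measure_tail[OF m _ s] by simp
      also have "\<dots> = (\<Prod>k\<in>{1..n}. ennreal (exp (- (m / s) * e k)))"
        by (simp only: prod_ennreal exp_ge_zero sum_distrib_left exp_sum finite_atLeastAtMost)
      finally show ?case .
    qed
  qed
  also have "\<dots> = (\<Prod>k\<in>{1..n}. ennreal (1 / (1 + m / s)))"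
    using m s
    by (subst PE.product_nn_integral_prod) (auto simp only: finite_atLeastAtMost
          exponential_measure_laplace[of "m / s"] divide_nonneg_pos less_imp_le intro!: prod.cong, measurable)
  also have "1 / (1 + m / s) = s / (s + m)" using s by (simp add: field_simps)
  finally show ?thesis
    using m s by (simp add: M.emeasure_eq_measure prod_ennreal ennreal_power)
qed

text \<open>
  Bounds the increments of \<open>b ^ n\<close> uniformly in the exponent: the derivative \<open>n * b ^ (n - 1)\<close> is
  at most \<open>1 + b + b\<^sup>2 + \<dots> = 1 / (1 - b)\<close>.
\<close>

lemma geometric_power_increment:
  fixes a b :: real
  assumes "0 \<le> a" "a \<le> b" "b < 1"
  shows "b ^ n - a ^ n \<le> (b - a) / (1 - b)"
proof -
  have "(1 - b) * (b ^ n - a ^ n) \<le> (b - a) * (1 - b ^ n)"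
  proof (induction n)
    case (Suc n)
    have "a * ((1 - b) * (b ^ n - a ^ n)) \<le> 1 * ((1 - b) * (b ^ n - a ^ n))"
      using assms by (intro mult_right_mono mult_nonneg_nonneg) (auto intro: power_mono)
    with Suc have "a * ((1 - b) * (b ^ n - a ^ n)) \<le> (b - a) * (1 - b ^ n)" by simp
    then show ?case by (simp add: algebra_simps)
  qed simp
  also have "\<dots> \<le> (b - a) * 1"
    using assms by (intro mult_left_mono) auto
  finally show ?thesis using assms by (simp add: field_simps)
qed

lemma gcp_measurable:
  assumes "gcp_interarrivals M l D" "1 \<le> k"
  shows "D k \<in> borel_measurable M"
  using assms by (auto simp: gcp_interarrivals_def mixed_poisson_interarrivals_def)

lemma gcp_arrival_cdf:
  assumes "prob_space M" "gcp_interarrivals M l D" "0 < l" "0 < s"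
  shows "measure M {\<omega> \<in> space M. (\<Sum>k=1..n. D k \<omega>) \<le> s} = (s / (s + 1 / l)) ^ n"
  using assms mixed_poisson_arrival_cdf[of M "1 / l"] by (auto simp: gcp_interarrivals_def)

text \<open>
  Every arrival time has a density at most \<open>1 / u\<close> at \<open>u\<close>, whatever the index \<open>n\<close> and the
  intensity \<open>l\<close>. This uniformity is what allows the union over all cycles below.
\<close>

lemma gcp_arrival_window:
  assumes "prob_space M" and gcp: "gcp_interarrivals M l D" and "0 < l" "0 < u" "0 \<le> h"
  shows "measure M {\<omega> \<in> space M. (\<Sum>k=1..n. D k \<omega>) \<in> {u<..u + h}} \<le> h / u"
proof -
  interpret prob_space M by fact
  define m where "m = 1 / l"
  have m: "m > 0" using \<open>0 < l\<close> by (simp add: m_def)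
  note gcp_measurable[OF gcp, measurable]
  let ?S = "\<lambda>\<omega>. \<Sum>k=1..n. D k \<omega>"
  have [measurable]: "?S \<in> borel_measurable M" by (intro borel_measurable_sum) auto
  have eq: "{\<omega> \<in> space M. ?S \<omega> \<in> {u<..u + h}} = {\<omega> \<in> space M. ?S \<omega> \<le> u + h} - {\<omega> \<in> space M. ?S \<omega> \<le> u}"
    by auto
  have "prob {\<omega> \<in> space M. ?S \<omega> \<in> {u<..u + h}}
      = prob {\<omega> \<in> space M. ?S \<omega> \<le> u + h} - prob {\<omega> \<in> space M. ?S \<omega> \<le> u}"
    unfolding eq
  proof (rule finite_measure_Diff)
    show "{\<omega> \<in> space M. ?S \<omega> \<le> u} \<subseteq> {\<omega> \<in> space M. ?S \<omega> \<le> u + h}"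
      using \<open>0 \<le> h\<close> by (intro Collect_mono) linarith
  qed measurable
  also have "\<dots> = ((u + h) / (u + h + m)) ^ n - (u / (u + m)) ^ n"
    unfolding m_def using assms
    by (intro arg_cong2[where f = "(-)"] gcp_arrival_cdf add_pos_nonneg)
  also have "\<dots> \<le> ((u + h) / (u + h + m) - u / (u + m)) / (1 - (u + h) / (u + h + m))"
    using assms m by (intro geometric_power_increment) (auto simp: field_simps)
  also have "\<dots> = h / (u + m)"
  proof -
    have "1 - (u + h) / (u + h + m) = m / (u + h + m)"
      "(u + h) / (u + h + m) - u / (u + m) = h * m / ((u + h + m) * (u + m))"
      using assms m by (simp_all add: divide_simps) (simp_all add: algebra_simps)
    then show ?thesis using assms m by simp
  qed
  also have "\<dots> \<le> h / u" using assms m by (intro divide_left_mono) auto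
  finally show ?thesis .
qed

lemma gcp_nonneg:
  assumes "prob_space M" and gcp: "gcp_interarrivals M l D" and "0 < l"
  shows "AE \<omega> in M. \<forall>k\<ge>1. 0 \<le> D k \<omega>"
proof -
  from gcp obtain \<alpha> where \<alpha>: "distributed M lborel \<alpha> (exponential_density (1 / l))"
    "mixed_poisson_interarrivals M \<alpha> D" by (auto simp: gcp_interarrivals_def)
  have "AE \<omega> in M. 0 \<le> D k \<omega>" if k: "1 \<le> k" for k
  proof -
    note gcp_measurable[OF gcp k, measurable]
    have "emeasure M {\<omega> \<in> space M. D k \<omega> < 0}
      = (\<integral>\<^sup>+a. emeasure (exponential_measure 1) {e. e / a < 0} \<partial>exponential_measure (1 / l))"
      using mixed_poisson_rectangle[OF assms(1) _ \<alpha>, of "{k}" "\<lambda>_. {..<0}"] k \<open>0 < l\<close> by simp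
    also have "\<dots> = (\<integral>\<^sup>+a. 0 \<partial>exponential_measure (1 / l))"
    proof (rule nn_integral_cong_AE)
      have null: "emeasure (exponential_measure 1) {..<0} = 0"
      proof -
        have "AE e in exponential_measure 1. \<not> e < 0"
          using AE_exponential_measure_pos by eventually_elim simp
        then show ?thesis by (subst (asm) AE_iff_measurable[OF _ refl]) (auto simp: lessThan_def)
      qed
      show "AE a in exponential_measure (1 / l). emeasure (exponential_measure 1) {e. e / a < 0} = 0"
        using AE_exponential_measure_pos
      proof eventually_elim
        case (elim a)
        then have "{e. e / a < 0} = {..<0}" by (auto simp: divide_less_0_iff)
        then show ?case by (simp only: null)
      qed
    qed
    finally show ?thesis by (subst AE_iff_measurable[OF _ refl]) (auto simp: not_le)
  qed
  then show ?thesis by (simp add: AE_all_countable)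
qed

text \<open>
  The probability that all arrivals occur before \<open>t\<close> is at most any power of \<open>t / (t + 1 / l)\<close>, a
  number less than 1.
\<close>

lemma gcp_nonexplosion:
  assumes "prob_space M" and gcp: "gcp_interarrivals M l D" and "0 < l" "0 < t"
  shows "AE \<omega> in M. \<exists>n. t < (\<Sum>k=1..n. D k \<omega>)"
proof -
  interpret prob_space M by fact
  note gcp_measurable[OF gcp, measurable]
  let ?S = "\<lambda>n \<omega>. \<Sum>k=1..n. D k \<omega>"
  have [measurable]: "?S n \<in> borel_measurable M" for n by (intro borel_measurable_sum) auto
  let ?A = "{\<omega> \<in> space M. \<forall>n. ?S n \<omega> \<le> t}"
  have "prob ?A \<le> prob {\<omega> \<in> space M. ?S n \<omega> \<le> t}" for n
    by (rule finite_measure_mono) auto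
  then have "prob ?A \<le> (t / (t + 1 / l)) ^ n" for n
    unfolding gcp_arrival_cdf[OF assms] .
  moreover have "(\<lambda>n. (t / (t + 1 / l)) ^ n) \<longlonglongrightarrow> 0"
    using assms by (intro LIMSEQ_power_zero) (simp add: divide_less_eq_1 add_pos_pos)
  ultimately have "prob ?A \<le> 0"
    by (intro LIMSEQ_le_const) auto
  then have "emeasure M ?A = 0" by (simp add: emeasure_eq_measure measure_le_0_iff)
  then show ?thesis by (subst AE_iff_measurable[OF _ refl]) (auto simp: not_less)
qed

section \<open>Probability of hitting a small ball\<close>

lemma indep_arrival_times:
  assumes "prob_space M"
    and indep: "prob_space.indep_vars M (\<lambda>_. \<Pi>\<^sub>M k\<in>{1..}. borel) (\<lambda>j \<omega>. \<lambda>k\<in>{1..}. D j k \<omega>) J"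
  shows "prob_space.indep_vars M (\<lambda>_. borel) (\<lambda>j \<omega>. \<Sum>k=1..\<kappa> j. D j k \<omega> :: real) J"
proof -
  interpret prob_space M by fact
  have "indep_vars (\<lambda>_. borel) (\<lambda>j \<omega>. \<Sum>k=1..\<kappa> j. (\<lambda>k\<in>{1..}. D j k \<omega>) k) J"
    by (rule indep_vars_compose2[OF indep]) (intro borel_measurable_sum measurable_component_singleton, auto)
  moreover have "(\<lambda>j \<omega>. \<Sum>k=1..\<kappa> j. (\<lambda>k\<in>{1..}. D j k \<omega>) k) = (\<lambda>j \<omega>. \<Sum>k=1..\<kappa> j. D j k \<omega>)"
    by (intro ext sum.cong) auto
  ultimately show ?thesis by (simp only:)
qed

text \<open>
  The constraints on the arrival times that hold when direction \<open>j\<close> is the current one and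
  \<open>\<kappa> i\<close> displacements in direction \<open>i\<close> are complete.
\<close>

definition arrival_cell ::
    "'a measure \<Rightarrow> (nat \<Rightarrow> nat \<Rightarrow> 'a \<Rightarrow> real) \<Rightarrow> real \<Rightarrow> (nat \<Rightarrow> real) \<Rightarrow> real \<Rightarrow> nat \<Rightarrow> (nat \<Rightarrow> nat) \<Rightarrow> 'a set" where
  "arrival_cell M D t u h j \<kappa> =
     {\<omega> \<in> space M. (\<forall>i\<in>{1..4} - {j}. (\<Sum>k=1..\<kappa> i. D i k \<omega>) \<in> {u i<..u i + h}) \<and>
        (\<Sum>k=1..\<kappa> j. D j k \<omega>) \<le> t}"

text \<open>
  By independence the probability is a product. The three windows give the factor \<open>(h / b) ^ 3\<close>,
  and the geometric law of the remaining clock gives a factor that is summable over the cycles.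
\<close>

lemma arrival_cell_bound:
  assumes "prob_space M"
    and l: "\<And>j. j \<in> {1..4} \<Longrightarrow> l j > 0"
    and gcp: "\<And>j. j \<in> {1..4} \<Longrightarrow> gcp_interarrivals M (l j) (D j)"
    and indep: "prob_space.indep_vars M (\<lambda>_. \<Pi>\<^sub>M k\<in>{1..}. borel) (\<lambda>j \<omega>. \<lambda>k\<in>{1..}. D j k \<omega>) {1..4}"
    and j: "j \<in> {1..4}" and t: "0 < t" and h: "0 \<le> h" and b: "0 < b" and u: "\<And>i. i \<in> {1..4} \<Longrightarrow> b \<le> u i"
  shows "arrival_cell M D t u h j \<kappa> \<in> sets M"
    and "measure M (arrival_cell M D t u h j \<kappa>) \<le> (h / b) ^ 3 * (t / (t + 1 / l j)) ^ \<kappa> j"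
proof -
  interpret prob_space M by fact
  define S where "S i \<omega> = (\<Sum>k=1..\<kappa> i. D i k \<omega>)" for i \<omega>
  define A where "A i = (if i = j then {..t} else {u i<..u i + h})" for i
  have A_sets: "A i \<in> sets borel" for i by (simp add: A_def)
  have indepS: "indep_vars (\<lambda>_. borel) S {1..4}"
    unfolding S_def by (rule indep_arrival_times[OF assms(1) indep])
  have S_meas[measurable]: "S i \<in> borel_measurable M" if "i \<in> {1..4}" for i
    using indepS that by (auto simp: indep_vars_def)
  have cell: "arrival_cell M D t u h j \<kappa> = (\<Inter>i\<in>{1..4}. S i -` A i \<inter> space M)"
  proof -
    have I: "{1..4} = insert j ({1..4} - {j})" using j by auto
    show ?thesis by (subst I) (auto simp: arrival_cell_def S_def A_def)
  qed
  show "arrival_cell M D t u h j \<kappa> \<in> sets M"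
    unfolding cell by (intro sets.finite_INT measurable_sets[OF S_meas A_sets]) auto
  have "prob (arrival_cell M D t u h j \<kappa>) = (\<Prod>i\<in>{1..4}. prob (S i -` A i \<inter> space M))"
    unfolding cell by (rule indep_varsD_finite[OF indepS]) (use A_sets in auto)
  also have "\<dots> = prob (S j -` A j \<inter> space M) * (\<Prod>i\<in>{1..4} - {j}. prob (S i -` A i \<inter> space M))"
    using j by (intro prod.remove) auto
  also have "prob (S j -` A j \<inter> space M) = (t / (t + 1 / l j)) ^ \<kappa> j"
  proof -
    have "S j -` A j \<inter> space M = {\<omega> \<in> space M. (\<Sum>k=1..\<kappa> j. D j k \<omega>) \<le> t}"
      by (auto simp: A_def S_def)
    then show ?thesis using gcp_arrival_cdf[OF assms(1) gcp[OF j] l[OF j] t] by simp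
  qed
  also have "(\<Prod>i\<in>{1..4} - {j}. prob (S i -` A i \<inter> space M)) \<le> (\<Prod>i\<in>{1..4} - {j}. h / b)"
  proof (intro prod_mono conjI measure_nonneg)
    fix i assume i: "i \<in> {1..4} - {j}"
    then have ui: "b \<le> u i" using u by auto
    have "S i -` A i \<inter> space M = {\<omega> \<in> space M. (\<Sum>k=1..\<kappa> i. D i k \<omega>) \<in> {u i<..u i + h}}"
      using i by (auto simp: A_def S_def)
    then have "prob (S i -` A i \<inter> space M) \<le> h / u i"
      using gcp_arrival_window[OF assms(1) gcp l, of i "u i" h "\<kappa> i"] i ui b h by simp
    also have "\<dots> \<le> h / b" using ui b h by (intro divide_left_mono) auto
    finally show "prob (S i -` A i \<inter> space M) \<le> h / b" .
  qed
  also have "(\<Prod>i\<in>{1..4} - {j}. h / b) = (h / b) ^ 3" using j by simp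
  finally show "prob (arrival_cell M D t u h j \<kappa>) \<le> (h / b) ^ 3 * (t / (t + 1 / l j)) ^ \<kappa> j"
    using l[OF j] t by (simp add: mult.commute mult_left_mono add_pos_pos less_imp_le)
qed

text \<open>
  When finitely many switches occur before \<open>t\<close>, the last of them determines the current cycle and
  direction.
\<close>

lemma position_in_ball_imp_cell:
  assumes nonneg: "\<And>j k. j \<in> {1..4} \<Longrightarrow> 1 \<le> k \<Longrightarrow> 0 \<le> D j k \<omega>"
    and explode: "t < (\<Sum>k=1..N. D 1 k \<omega>)" and t: "0 < t"
    and c: "c > 0" and ball: "position c (\<lambda>j k. D j k \<omega>) t \<in> ball x r" and \<omega>: "\<omega> \<in> space M"
  shows "\<exists>n. \<exists>j\<in>{1..4}. \<omega> \<in> arrival_cell M D t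
           (\<lambda>i. t / 4 + 3 / (4 * c) * (x \<bullet> tetra_dir i - r)) (3 * r / (2 * c)) j
           (completed (4 * n + j - 1))"
proof -
  define d where "d j k = D j k \<omega>" for j k
  have nn: "\<And>j k. j \<in> {1..4} \<Longrightarrow> 1 \<le> k \<Longrightarrow> 0 \<le> d j k" using nonneg by (simp add: d_def)
  have "t < total_duration d 1 N" using explode by (simp add: total_duration_def d_def)
  also have "\<dots> \<le> switching_time d (4 * N)"
  proof -
    have "completed (4 * N) 1 = N" using completed_cycle[of 1 1 N] by (simp add: completed_def)
    moreover have "total_duration d 1 (completed (4 * N) 1) \<le> switching_time d (4 * N)"
      unfolding switching_time_eq_sum_completed using nn
      by (intro member_le_sum) (auto simp: total_duration_def intro!: sum_nonneg)
    ultimately show ?thesis by simp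
  qed
  finally have ex: "\<exists>m. t < switching_time d m" by blast
  define m' where "m' = (LEAST m. t < switching_time d m)"
  have m': "t < switching_time d m'" unfolding m'_def using ex by (rule LeastI_ex)
  have "m' \<noteq> 0" using m' t by (auto simp: switching_time_0 intro: Nat.gr0I)
  then obtain m where m: "m' = Suc m" by (cases m') auto
  have "\<not> t < switching_time d m"
    using not_less_Least[of m "\<lambda>m. t < switching_time d m"] m by (simp add: m'_def)
  then have between: "switching_time d m \<le> t" "t \<le> switching_time d (Suc m)"
    using m' m by auto
  obtain n j where j: "j \<in> {1..4}" "m = 4 * n + j - 1" "m mod 4 + 1 = j"
    by (rule index_as_cycle)
  have pos: "position c d t \<in> ball x r" using ball by (simp add: d_def[abs_def])
  have "total_duration d i (completed m i) \<in> {t / 4 + 3 / (4 * c) * (x \<bullet> tetra_dir i - r)<..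
      t / 4 + 3 / (4 * c) * (x \<bullet> tetra_dir i - r) + 3 * r / (2 * c)}" if "i \<in> {1..4} - {j}" for i
    by (rule durations_of_position_in_ball(1)[OF _ between c pos]) (use that j(3) nn in auto)
  moreover have "total_duration d j (completed m j) \<le> t"
    using durations_of_position_in_ball(2)[OF _ between c pos] nn unfolding j(3) by blast
  ultimately have "\<omega> \<in> arrival_cell M D t (\<lambda>i. t / 4 + 3 / (4 * c) * (x \<bullet> tetra_dir i - r)) (3 * r / (2 * c)) j
           (completed (4 * n + j - 1))"
    using \<omega> unfolding j(2)[symmetric] by (simp add: arrival_cell_def total_duration_def d_def)
  then show ?thesis using j(1) by blast
qed

text \<open>
  The main estimate. Three windows of width \<open>3 * r / (2 * c)\<close> located beyond \<open>t / 8\<close> give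
  \<open>(12 * r / (c * t)) ^ 3\<close>, and summing the geometric factors over the cycles costs only the expected
  number of arrivals before \<open>t\<close>, of order \<open>t\<close>. The event is only covered by a measurable set, since the
  position is not shown to be measurable in \<open>\<omega>\<close>.
\<close>

lemma position_in_ball_bound:
  assumes "prob_space M" and c: "c > 0"
    and l: "\<And>j. j \<in> {1..4} \<Longrightarrow> l j > 0"
    and gcp: "\<And>j. j \<in> {1..4} \<Longrightarrow> gcp_interarrivals M (l j) (D j)"
    and indep: "prob_space.indep_vars M (\<lambda>_. \<Pi>\<^sub>M k\<in>{1..}. borel) (\<lambda>j \<omega>. \<lambda>k\<in>{1..}. D j k \<omega>) {1..4}"
    and r: "0 \<le> r" "r \<le> 1" and t: "6 * (norm x + 1) / c \<le> t"
  obtains A where "A \<in> sets M"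
    "{\<omega> \<in> space M. position c (\<lambda>j k. D j k \<omega>) t \<in> ball x r} \<subseteq> A"
    "measure M A \<le> 4 * (12 * r / (c * t)) ^ 3 * (1 + (\<Sum>j=1..4. l j) * t)"
proof -
  interpret prob_space M by fact
  define L where "L = (\<Sum>j=1..4. l j)"
  define u where "u i = t / 4 + 3 / (4 * c) * (x \<bullet> tetra_dir i - r)" for i
  define h where "h = 3 * r / (2 * c)"
  \<comment> \<open>a common ratio for the four geometric laws, replacing each intensity by their sum\<close>
  define q where "q = L * t / (1 + L * t)"
  define E where "E n j = arrival_cell M D t u h j (completed (4 * n + j - 1))" for n j
  define F where "F n = (\<Union>j\<in>{1..4}. E n j)" for n
  have "0 < 6 * (norm x + 1) / c" using c by (intro divide_pos_pos) (auto intro: add_nonneg_pos)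
  with t have t0: "0 < t" by linarith
  have lL: "l j \<le> L" if "j \<in> {1..4}" for j
    unfolding L_def using that l by (intro member_le_sum) (auto intro: less_imp_le)
  have L: "0 < L" using lL[of 1] l[of 1] by simp
  have Lt: "0 < 1 + L * t" using L t0 by (simp add: add_pos_pos)
  have u_ge: "t / 8 \<le> u i" if i: "i \<in> {1..4}" for i
  proof -
    have "norm (tetra_dir i) = 1" using tetra_dir_inner[OF i i] by (simp add: norm_eq_1)
    then have "\<bar>x \<bullet> tetra_dir i\<bar> \<le> norm x" using Cauchy_Schwarz_ineq2[of x "tetra_dir i"] by simp
    then have "3 / (4 * c) * (x \<bullet> tetra_dir i - r) \<ge> 3 / (4 * c) * (- (norm x + 1))"
      using r c by (intro mult_left_mono) auto
    moreover have "3 / (4 * c) * (- (norm x + 1)) \<ge> - (t / 8)"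
      using t c by (simp add: field_simps)
    ultimately show ?thesis unfolding u_def by linarith
  qed
  have h: "0 \<le> h" using r c by (simp add: h_def)
  have E_sets: "E n j \<in> sets M" if "j \<in> {1..4}" for n j
    unfolding E_def by (rule arrival_cell_bound(1)[OF assms(1) l gcp indep that t0 h _ u_ge]) (use t0 in auto)
  have E_le: "prob (E n j) \<le> (12 * r / (c * t)) ^ 3 * q ^ n" if j: "j \<in> {1..4}" for n j
  proof -
    have "prob (E n j) \<le> (h / (t / 8)) ^ 3 * (t / (t + 1 / l j)) ^ completed (4 * n + j - 1) j"
      unfolding E_def by (rule arrival_cell_bound(2)[OF assms(1) l gcp indep that t0 h _ u_ge]) (use t0 in auto)
    also have "completed (4 * n + j - 1) j = n" using completed_cycle[OF j j] by simp
    also have "h / (t / 8) = 12 * r / (c * t)" by (simp add: h_def)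
    also have "(12 * r / (c * t)) ^ 3 * (t / (t + 1 / l j)) ^ n \<le> (12 * r / (c * t)) ^ 3 * q ^ n"
    proof (intro mult_left_mono power_mono)
      have "0 < 1 + l j * t" using l[OF j] t0 by (simp add: add_pos_pos)
      then have "t / (t + 1 / l j) = 1 - 1 / (1 + l j * t)" using l[OF j] t0 by (simp add: field_simps)
      also have "\<dots> \<le> 1 - 1 / (1 + L * t)"
        using l[OF j] lL[OF j] t0 by (intro diff_left_mono divide_left_mono) (auto simp: add_pos_pos)
      also have "\<dots> = q" using Lt by (simp add: q_def field_simps)
      finally show "t / (t + 1 / l j) \<le> q" .
    qed (use r c t0 l[OF j] in auto)
    finally show ?thesis .
  qed
  have F_sets: "F n \<in> sets M" for n unfolding F_def using E_sets by auto
  have F_le: "prob (F n) \<le> 4 * (12 * r / (c * t)) ^ 3 * q ^ n" for n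
  proof -
    have "prob (F n) \<le> (\<Sum>j\<in>{1..4}. prob (E n j))"
      unfolding F_def using E_sets by (intro finite_measure_subadditive_finite) auto
    also have "\<dots> \<le> (\<Sum>j\<in>{1..4::nat}. (12 * r / (c * t)) ^ 3 * q ^ n)" by (intro sum_mono E_le)
    finally show ?thesis by simp
  qed
  have q: "0 \<le> q" "q < 1" "1 / (1 - q) = 1 + L * t"
    using L t0 Lt by (auto simp: q_def field_simps)
  have sums: "(\<lambda>n. 4 * (12 * r / (c * t)) ^ 3 * q ^ n) sums (4 * (12 * r / (c * t)) ^ 3 * (1 + L * t))"
    unfolding q(3)[symmetric] using q by (intro sums_mult geometric_sums) auto
  have summ: "summable (\<lambda>n. prob (F n))"
    by (rule summable_comparison_test'[OF sums_summable[OF sums], of 0]) (simp add: F_le)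
  have "prob (\<Union>n. F n) \<le> (\<Sum>n. prob (F n))"
    using F_sets summ by (intro finite_measure_subadditive_countably) auto
  also have "\<dots> \<le> (\<Sum>n. 4 * (12 * r / (c * t)) ^ 3 * q ^ n)"
    by (rule suminf_le[OF F_le summ sums_summable[OF sums]])
  also have "\<dots> = 4 * (12 * r / (c * t)) ^ 3 * (1 + L * t)" using sums by (rule sums_unique[symmetric])
  finally have U_le: "prob (\<Union>n. F n) \<le> 4 * (12 * r / (c * t)) ^ 3 * (1 + L * t)" .
  \<comment> \<open>the paths with negative durations or infinitely many switches before \<open>t\<close> lie in a null set\<close>
  have "AE \<omega> in M. (\<forall>j\<in>{1..4}. \<forall>k\<ge>1. 0 \<le> D j k \<omega>) \<and> (\<exists>n. t < (\<Sum>k=1..n. D 1 k \<omega>))"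
    using gcp_nonneg[OF assms(1) gcp l] gcp_nonexplosion[OF assms(1) gcp[of 1] l[of 1] t0]
    by (simp add: AE_ball_countable)
  then obtain N where N: "N \<in> null_sets M"
    "\<And>\<omega>. \<omega> \<in> space M - N \<Longrightarrow> (\<forall>j\<in>{1..4}. \<forall>k\<ge>1. 0 \<le> D j k \<omega>) \<and> (\<exists>n. t < (\<Sum>k=1..n. D 1 k \<omega>))"
    by (rule AE_E3) auto
  show ?thesis
  proof (rule that)
    show "(\<Union>n. F n) \<union> N \<in> sets M" using F_sets N(1) by auto
    show "measure M ((\<Union>n. F n) \<union> N) \<le> 4 * (12 * r / (c * t)) ^ 3 * (1 + (\<Sum>j=1..4. l j) * t)"
      using U_le F_sets N(1) by (subst measure_Un_null_set) (auto simp: L_def)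
    show "{\<omega> \<in> space M. position c (\<lambda>j k. D j k \<omega>) t \<in> ball x r} \<subseteq> (\<Union>n. F n) \<union> N"
    proof
      fix \<omega> assume \<omega>: "\<omega> \<in> {\<omega> \<in> space M. position c (\<lambda>j k. D j k \<omega>) t \<in> ball x r}"
      show "\<omega> \<in> (\<Union>n. F n) \<union> N"
      proof (cases "\<omega> \<in> N")
        case False
        with N(2)[of \<omega>] \<omega> obtain k where
          "\<And>j k. j \<in> {1..4} \<Longrightarrow> 1 \<le> k \<Longrightarrow> 0 \<le> D j k \<omega>" "t < (\<Sum>k=1..k. D 1 k \<omega>)" by blast
        from position_in_ball_imp_cell[of D \<omega> t k c x r M, OF this t0 c] \<omega>
        show ?thesis by (auto simp: F_def E_def u_def[abs_def] h_def)
      qed simp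
    qed
  qed
qed

section \<open>Decay of the density\<close>

text \<open>
  Bounds for the integrals over small balls in terms of their volume pass to the centre by
  continuity.
\<close>

lemma continuous_density_bound:
  fixes f :: "real^3 \<Rightarrow> real"
  assumes cont: "continuous_on U f" and U: "open U" "x \<in> U"
    and int: "\<And>r. 0 < r \<Longrightarrow> ball x r \<subseteq> U \<Longrightarrow> set_integrable lborel (ball x r) f"
    and nonneg: "\<And>r. 0 < r \<Longrightarrow> ball x r \<subseteq> U \<Longrightarrow> 0 \<le> (LINT y:ball x r|lborel. f y)"
    and le: "\<And>r. 0 < r \<Longrightarrow> r \<le> 1 \<Longrightarrow> ball x r \<subseteq> U \<Longrightarrow> (LINT y:ball x r|lborel. f y) \<le> C * measure lborel (ball x r)"
  shows "0 \<le> f x" "f x \<le> C"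
proof -
  have near: "\<exists>r. 0 < r \<and> r \<le> 1 \<and> ball x r \<subseteq> U \<and> (\<forall>y\<in>ball x r. \<bar>f y - f x\<bar> \<le> e)" if e: "0 < e" for e
  proof -
    obtain r1 where r1: "r1 > 0" "ball x r1 \<subseteq> U" using U openE by blast
    obtain r2 where r2: "r2 > 0" "\<And>y. y \<in> U \<Longrightarrow> dist y x < r2 \<Longrightarrow> dist (f y) (f x) < e"
      using cont U(2) e unfolding continuous_on_iff by metis
    show ?thesis
    proof (intro exI[of _ "min 1 (min r1 r2)"] conjI ballI)
      show "ball x (min 1 (min r1 r2)) \<subseteq> U" using r1(2) by (meson min.cobounded1 min.cobounded2 order_trans subset_ball)
      fix y assume y: "y \<in> ball x (min 1 (min r1 r2))"
      then have "y \<in> U" using r1(2) by auto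
      with y show "\<bar>f y - f x\<bar> \<le> e" using r2(2)[of y] by (simp add: dist_real_def dist_commute)
    qed (use r1 r2 in auto)
  qed
  have const: "(LINT y:ball x r|lborel. k) = k * measure lborel (ball x r)"
      "set_integrable lborel (ball x r) (\<lambda>_. k)" for k r :: real
  proof -
    have "integrable lborel (indicator (ball x r) :: _ \<Rightarrow> real)"
      by (intro integrable_real_indicator emeasure_lborel_ball_finite) simp
    then show "(LINT y:ball x r|lborel. k) = k * measure lborel (ball x r)"
      "set_integrable lborel (ball x r) (\<lambda>_. k)"
      by (simp_all add: set_lebesgue_integral_def set_integrable_def)
  qed
  have vol: "0 < measure lborel (ball x r)" if "0 < r" for r
    using content_ball_gt_0_iff[of x r] that by simp
  have "0 \<le> f x + e" if e: "0 < e" for e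
  proof -
    obtain r where r: "0 < r" "ball x r \<subseteq> U" "\<And>y. y \<in> ball x r \<Longrightarrow> \<bar>f y - f x\<bar> \<le> e"
      using near[OF e] by blast
    have "0 \<le> (LINT y:ball x r|lborel. f y)" using nonneg r by blast
    also have "\<dots> \<le> (LINT y:ball x r|lborel. f x + e)"
      by (rule set_integral_mono[OF int const(2)]) (use r in \<open>auto simp: abs_le_iff algebra_simps\<close>)
    finally show ?thesis using vol[OF r(1)] by (simp add: const zero_le_mult_iff)
  qed
  then show "0 \<le> f x" by (rule field_le_epsilon)
  have "f x \<le> C + e" if e: "0 < e" for e
  proof -
    obtain r where r: "0 < r" "r \<le> 1" "ball x r \<subseteq> U" "\<And>y. y \<in> ball x r \<Longrightarrow> \<bar>f y - f x\<bar> \<le> e"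
      using near[OF e] by blast
    have "(LINT y:ball x r|lborel. f x - e) \<le> (LINT y:ball x r|lborel. f y)"
      by (rule set_integral_mono[OF const(2) int]) (use r in \<open>auto simp: abs_le_iff algebra_simps\<close>)
    also have "\<dots> \<le> C * measure lborel (ball x r)" using le r by blast
    finally show ?thesis using vol[OF r(1)] by (simp add: const)
  qed
  then show "f x \<le> C" by (rule field_le_epsilon)
qed

theorem corollary2:
  fixes M :: "'a measure"
    and c :: real
    and l :: "nat \<Rightarrow> real"
    and D :: "nat \<Rightarrow> nat \<Rightarrow> 'a \<Rightarrow> real"
    and p :: "nat \<Rightarrow> real^3 \<Rightarrow> real \<Rightarrow> real"
    and x :: "real^3"
  assumes "prob_space M"
    and "c > 0"
    and "\<And>j. j \<in> {1..4} \<Longrightarrow> l j > 0"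
    and "\<And>j. j \<in> {1..4} \<Longrightarrow> gcp_interarrivals M (l j) (D j)"
    and "prob_space.indep_vars M (\<lambda>_. \<Pi>\<^sub>M k\<in>{1..}. borel) (\<lambda>j \<omega>. \<lambda>k\<in>{1..}. D j k \<omega>) {1..4}"
    and "\<And>j t. j \<in> {1..4} \<Longrightarrow> t > 0 \<Longrightarrow> is_direction_density M c D j t (\<lambda>y. p j y t)"
  shows "(\<forall>\<^sub>F t in at_top. x \<in> interior (tetrahedron c t)) \<and>
         ((\<lambda>t. \<Sum>j=1..4. p j x t) \<longlongrightarrow> 0) at_top"
proof
  interpret prob_space M by fact
  note c = \<open>c > 0\<close>
  define L where "L = (\<Sum>j=1..4. l j)"
  define X where "X t \<omega> = position c (\<lambda>j k. D j k \<omega>) t" for t \<omega>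
  define V where "V t \<omega> = velocity (\<lambda>j k. D j k \<omega>) t" for t \<omega>
  \<comment> \<open>\<open>G\<close> does not depend on \<open>t\<close>, so conditioning on the initial state only changes a constant\<close>
  define G where "G = prob {\<omega> \<in> space M. X 0 \<omega> = 0 \<and> V 0 \<omega> = tetra_dir 1}"
  \<comment> \<open>\<open>3 / pi\<close> is the constant 4 of the main estimate divided by the volume \<open>4 / 3 * pi\<close> of the unit ball\<close>
  define R where "R t = 3 / pi * (12 / (c * t)) ^ 3 * (1 + L * t) / G" for t
  have inside: "\<forall>\<^sub>F t in at_top. 0 < t \<and> x \<in> interior (tetrahedron c t)"
    using eventually_gt_at_top[of "3 * norm x / c"]
  proof eventually_elim
    case (elim t)
    have "0 \<le> 3 * norm x / c" using c by simp
    with elim have "0 < t" by linarith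
    moreover have "x \<in> ball 0 (c * t / 3)" using elim c by (simp add: field_simps)
    then have "x \<in> interior (tetrahedron c t)"
      using ball_subset_tetrahedron[OF c \<open>0 < t\<close>] by (meson interiorI open_ball)
    ultimately show ?case by simp
  qed
  then show "\<forall>\<^sub>F t in at_top. x \<in> interior (tetrahedron c t)" by eventually_elim simp
  have bound: "0 \<le> p j x t \<and> p j x t \<le> R t"
    if j: "j \<in> {1..4}" and t: "0 < t" "x \<in> interior (tetrahedron c t)" "6 * (norm x + 1) / c \<le> t" for j t
  proof -
    let ?U = "interior (tetrahedron c t)"
    have dens: "is_direction_density M c D j t (\<lambda>y. p j y t)" using assms(6) j t by simp
    have prob_eq: "(LINT y:ball x r|lborel. p j y t)
        = prob {\<omega> \<in> space M. (X t \<omega> \<in> ball x r \<and> V t \<omega> = tetra_dir j) \<and> X 0 \<omega> = 0 \<and> V 0 \<omega> = tetra_dir 1} / G"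
      and int: "set_integrable lborel (ball x r) (\<lambda>y. p j y t)" if "ball x r \<subseteq> ?U" for r
      using dens that by (auto simp: is_direction_density_def cond_prob_def X_def V_def G_def)
    have "(LINT y:ball x r|lborel. p j y t) \<le> R t * measure lborel (ball x r)"
      if r: "0 < r" "r \<le> 1" "ball x r \<subseteq> ?U" for r
    proof -
      obtain A where A: "A \<in> sets M" "{\<omega> \<in> space M. X t \<omega> \<in> ball x r} \<subseteq> A"
          "prob A \<le> 4 * (12 * r / (c * t)) ^ 3 * (1 + L * t)"
        using position_in_ball_bound[OF assms(1) c assms(3,4,5) less_imp_le[OF r(1)] r(2) t(3)]
        unfolding X_def L_def by blast
      have "prob {\<omega> \<in> space M. (X t \<omega> \<in> ball x r \<and> V t \<omega> = tetra_dir j) \<and> X 0 \<omega> = 0 \<and> V 0 \<omega> = tetra_dir 1} \<le> prob A"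
        using A by (intro finite_measure_mono) auto
      also note A(3)
      finally have "(LINT y:ball x r|lborel. p j y t) \<le> 4 * (12 * r / (c * t)) ^ 3 * (1 + L * t) / G"
        unfolding prob_eq[OF r(3)] by (intro divide_right_mono) (simp_all add: G_def)
      also have "\<dots> = R t * measure lborel (ball x r)"
      proof -
        have "(12 * r / (c * t)) ^ 3 = r ^ 3 * (12 / (c * t)) ^ 3"
          by (simp add: power_mult_distrib power_divide)
        then show ?thesis using r(1) by (simp add: sphere_volume R_def mult_ac)
      qed
      finally show ?thesis .
    qed
    moreover have "0 \<le> (LINT y:ball x r|lborel. p j y t)" if "ball x r \<subseteq> ?U" for r
      unfolding prob_eq[OF that] by (simp add: G_def)
    moreover have "continuous_on ?U (\<lambda>y. p j y t)" using dens by (simp add: is_direction_density_def)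
    ultimately show ?thesis
      using continuous_density_bound[of ?U "\<lambda>y. p j y t" x "R t"] int t(2) by blast
  qed
  have "(R \<longlongrightarrow> 0) at_top"
  proof -
    have inv: "((\<lambda>t. 1 / t) \<longlongrightarrow> (0::real)) at_top" 
      by (rule tendsto_divide_0[OF tendsto_const filterlim_at_top_imp_at_infinity[OF filterlim_ident]])
    have "((\<lambda>t. 3 / pi * (12 / c) ^ 3 / G * ((1 / t) ^ 3 + L * (1 / t) ^ 2)) \<longlongrightarrow> 3 / pi * (12 / c) ^ 3 / G * (0 ^ 3 + L * 0 ^ 2)) at_top"
      by (intro tendsto_intros inv)
    moreover have "\<forall>\<^sub>F t in at_top. 3 / pi * (12 / c) ^ 3 / G * ((1 / t) ^ 3 + L * (1 / t) ^ 2) = R t"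
      using eventually_gt_at_top[of 0]
      by eventually_elim (use c in \<open>simp add: R_def power_divide power_mult_distrib field_simps power2_eq_square power3_eq_cube\<close>)
    ultimately show ?thesis by (simp add: filterlim_cong cong: filterlim_cong)
  qed
  then have lim: "((\<lambda>t. 4 * R t) \<longlongrightarrow> 0) at_top" by (rule tendsto_mult_right_zero)
  have "\<forall>\<^sub>F t in at_top. norm (\<Sum>j=1..4. p j x t) \<le> 4 * R t"
    using inside eventually_ge_at_top[of "6 * (norm x + 1) / c"]
  proof eventually_elim
    case (elim t)
    have "norm (\<Sum>j=1..4. p j x t) \<le> (\<Sum>j\<in>{1..4::nat}. R t)"
      using bound[of _ t] elim by (intro sum_norm_le) auto
    then show ?case by simp
  qed
  then show "((\<lambda>t. \<Sum>j=1..4. p j x t) \<longlongrightarrow> 0) at_top"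
    using lim by (rule Lim_null_comparison)
qed

end
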